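(* Let $p$ be a prime and $n>1$ an integer. If $G$ is a finite $p$-group with $G\in\mathcal{D}_n$, then $G$ has nilpotency class at most $n/2$ and derived length at most $\log_2(n/2)+1$.
   Context: $\mathcal{D}(G)$ denotes the number of conjugacy classes of nontrivial subgroups $H$ of the finite group $G$ with $N_G(H)\neq H$; $\mathcal{D}_n$ is the family of finite groups $G$ with $\mathcal{D}(G)=n$. *)

theory Defs
  imports "HOL-Algebra.Algebra"
begin

definition subgroup_conj_class :: "('a, 'b) monoid_scheme \<Rightarrow> 'a set \<Rightarrow> 'a set set" where
  "subgroup_conj_class G H = {g <#\<^bsub>G\<^esub> H #>\<^bsub>G\<^esub> inv\<^bsub>G\<^esub> g | g. g \<in> carrier G}"

definition D_count :: "('a, 'b) monoid_scheme \<Rightarrow> nat" where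
  "D_count G = card {subgroup_conj_class G H | H.
      subgroup H G \<and> H \<noteq> {\<one>\<^bsub>G\<^esub>} \<and> normalizer G H \<noteq> H}"

definition comm_subgroup :: "('a, 'b) monoid_scheme \<Rightarrow> 'a set \<Rightarrow> 'a set \<Rightarrow> 'a set" where
  "comm_subgroup G A B = generate G
     {a \<otimes>\<^bsub>G\<^esub> b \<otimes>\<^bsub>G\<^esub> inv\<^bsub>G\<^esub> a \<otimes>\<^bsub>G\<^esub> inv\<^bsub>G\<^esub> b | a b. a \<in> A \<and> b \<in> B}"

text \<open>Lower central series, indexed from 0: lower_central G 0 = G = gamma_1,
  lower_central G (i+1) = [lower_central G i, G] = gamma_(i+2).\<close>
fun lower_central :: "('a, 'b) monoid_scheme \<Rightarrow> nat \<Rightarrow> 'a set" where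
  "lower_central G 0 = carrier G"
| "lower_central G (Suc i) = comm_subgroup G (lower_central G i) (carrier G)"

definition nilpotency_class :: "('a, 'b) monoid_scheme \<Rightarrow> nat" where
  "nilpotency_class G = (LEAST c. lower_central G c = {\<one>\<^bsub>G\<^esub>})"

definition derived_length :: "('a, 'b) monoid_scheme \<Rightarrow> nat" where
  "derived_length G = (LEAST d. (derived G ^^ d) (carrier G) = {\<one>\<^bsub>G\<^esub>})"

definition p_group :: "nat \<Rightarrow> ('a, 'b) monoid_scheme \<Rightarrow> bool" where
  "p_group p G \<longleftrightarrow> group G \<and> finite (carrier G) \<and> (\<exists>k. card (carrier G) = p ^ k)"

end

theory Submission
  imports Defs
begin

text \<open>
  In a finite \<open>p\<close>-group normalizers grow, so \<open>D_count\<close> counts the conjugacy classes of all nontrivial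
  proper subgroups. If \<open>G\<close> has order \<open>p\<^sup>k\<close> and is not cyclic, its class is at most \<open>k - 1\<close>, because
  the last factor of the upper central series is not cyclic. On the other hand \<open>G\<close> has a normal
  subgroup of each order, at least two subgroups of order \<open>p\<^sup>i\<close> for \<open>2 \<le> i < k\<close>, and at least three
  subgroups of index \<open>p\<close>, all of them normal; this gives at least \<open>2 (k - 1)\<close> conjugacy classes.
  Two subgroups of order \<open>p\<^sup>i\<close> are found by descending through noncyclic subgroups of index \<open>p\<close>,
  which exist as long as the order is at least \<open>p\<^sup>4\<close>. The derived length is bounded by the class, as the
  \<open>d\<close>-th derived subgroup is contained in the \<open>2\<^sup>d\<close>-th term of the lower central series.
\<close>

section \<open>Commutators and the lower central series\<close>

context group
begin

abbreviation commutator :: "'a \<Rightarrow> 'a \<Rightarrow> 'a"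
  where "commutator x y \<equiv> x \<otimes> y \<otimes> inv x \<otimes> inv y"

lemma inv_mult_cancel [simp]:
  assumes "x \<in> carrier G" "y \<in> carrier G"
  shows "inv x \<otimes> (x \<otimes> y) = y" "x \<otimes> (inv x \<otimes> y) = y"
  using assms by (simp_all flip: m_assoc)

text \<open>For normal \<open>N\<close> this is the preimage in \<open>G\<close> of the centralizer
  of the image of \<open>B\<close> in \<open>G Mod N\<close>. With \<open>B = carrier G\<close> it
  is the preimage of the centre. Stating it through commutators keeps the calculations inside
  \<open>G\<close>.\<close>

definition centralizer_mod :: "'a set \<Rightarrow> 'a set \<Rightarrow> 'a set"
  where "centralizer_mod N B = {x \<in> carrier G. \<forall>b\<in>B. commutator x b \<in> N}"

text \<open>A commutator with \<open>inv x\<close> or \<open>x \<otimes> y\<close> in the first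
  place is a product of conjugates of commutators with \<open>x\<close> and \<open>y\<close> or
  their inverses, and \<open>N\<close> is closed under conjugation.\<close>

lemma subgroup_centralizer_mod:
  assumes N: "N \<lhd> G" and B: "B \<subseteq> carrier G"
  shows "subgroup (centralizer_mod N B) G"
proof
  interpret N: normal N G by fact
  show "centralizer_mod N B \<subseteq> carrier G" "\<one> \<in> centralizer_mod N B"
    using B by (auto simp: centralizer_mod_def)
  fix x assume x: "x \<in> centralizer_mod N B"
  then have xG: "x \<in> carrier G" by (simp add: centralizer_mod_def)
  show "inv x \<in> centralizer_mod N B"
  proof -
    have "commutator (inv x) b \<in> N" if b: "b \<in> B" for b
    proof -
      have bG: "b \<in> carrier G" using b B by auto
      have "inv x \<otimes> inv (commutator x b) \<otimes> x \<in> N"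
        by (rule N.inv_op_closed1[OF _ N.m_inv_closed])
          (use x b xG in \<open>auto simp: centralizer_mod_def\<close>)
      moreover have "inv x \<otimes> inv (commutator x b) \<otimes> x = commutator (inv x) b"
        using xG bG by (simp add: m_assoc inv_mult_group)
      ultimately show ?thesis by simp
    qed
    then show ?thesis using xG by (simp add: centralizer_mod_def)
  qed
  fix y assume y: "y \<in> centralizer_mod N B"
  then have yG: "y \<in> carrier G" by (simp add: centralizer_mod_def)
  show "x \<otimes> y \<in> centralizer_mod N B"
  proof -
    have "commutator (x \<otimes> y) b \<in> N" if b: "b \<in> B" for b
    proof -
      have bG: "b \<in> carrier G" using b B by auto
      have "(x \<otimes> commutator y b \<otimes> inv x) \<otimes> commutator x b \<in> N"
        by (rule N.m_closed[OF N.inv_op_closed2])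
          (use x y b xG in \<open>auto simp: centralizer_mod_def\<close>)
      moreover have "(x \<otimes> commutator y b \<otimes> inv x) \<otimes> commutator x b = commutator (x \<otimes> y) b"
        using xG yG bG by (simp add: m_assoc inv_mult_group)
      ultimately show ?thesis by simp
    qed
    then show ?thesis using xG yG by (simp add: centralizer_mod_def)
  qed
qed

text \<open>A conjugate of \<open>h\<close> differs from \<open>h\<close> by a commutator, which
  lies in \<open>K\<close> and hence in \<open>H\<close>. In other words, subgroups of the centre of
  \<open>G Mod K\<close> are normal.\<close>

lemma normal_between_centralizer_mod:
  assumes K: "K \<lhd> G" and H: "subgroup H G" "K \<subseteq> H" "H \<subseteq> centralizer_mod K (carrier G)"
  shows "H \<lhd> G"
proof (rule normal_invI[OF H(1)])
  fix g h assume g: "g \<in> carrier G" and h: "h \<in> H"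
  interpret K: normal K G by fact
  have hG: "h \<in> carrier G" using H(1) h by (rule subgroup.mem_carrier)
  have "commutator h g \<in> K" using h g H(3) by (auto simp: centralizer_mod_def)
  then have "inv (commutator h g) \<in> H" using H(2) K.m_inv_closed by blast
  then have "inv (commutator h g) \<otimes> h \<in> H" using H(1) h by (simp add: subgroup.m_closed)
  moreover have "inv (commutator h g) \<otimes> h = g \<otimes> h \<otimes> inv g"
    using g hG by (simp add: m_assoc inv_mult_group)
  ultimately show "g \<otimes> h \<otimes> inv g \<in> H" by simp
qed

lemma centralizer_mod_contains:
  assumes K: "K \<lhd> G" shows "K \<subseteq> centralizer_mod K (carrier G)"
proof
  interpret K: normal K G by fact
  fix x assume x: "x \<in> K"
  have "commutator x g \<in> K" if g: "g \<in> carrier G" for g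
  proof -
    have "x \<otimes> (g \<otimes> inv x \<otimes> inv g) \<in> K"
      using x g by (intro K.m_closed K.inv_op_closed2) auto
    then show ?thesis using x g by (simp add: m_assoc)
  qed
  then show "x \<in> centralizer_mod K (carrier G)" using x by (simp add: centralizer_mod_def)
qed

lemma normal_centralizer_mod:
  assumes "K \<lhd> G" shows "centralizer_mod K (carrier G) \<lhd> G"
  using assms
  by (rule normal_between_centralizer_mod)
    (simp_all add: assms subgroup_centralizer_mod centralizer_mod_contains)

text \<open>By the Hall--Witt identity.\<close>

lemma three_subgroups_element:
  assumes N: "N \<lhd> G" and [simp]: "x \<in> carrier G" "y \<in> carrier G" "z \<in> carrier G"
    and 1: "commutator (commutator z (inv y)) (inv x) \<in> N"
    and 2: "commutator (commutator x (inv z)) (inv y) \<in> N"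
  shows "commutator (commutator y (inv x)) (inv z) \<in> N"
proof -
  interpret N: normal N G by fact
  let ?p = "commutator (commutator y (inv x)) (inv z)"
  let ?q = "commutator (commutator z (inv y)) (inv x)"
  let ?r = "commutator (commutator x (inv z)) (inv y)"
  define q r where "q = inv z \<otimes> ?q \<otimes> z" and "r = inv x \<otimes> ?r \<otimes> x"
  have q: "q \<in> N" unfolding q_def by (rule N.inv_op_closed1) (use 1 in auto)
  have r: "r \<in> N" unfolding r_def by (rule N.inv_op_closed1) (use 2 in auto)
  have "?p = y \<otimes> inv (q \<otimes> r) \<otimes> inv y"
    unfolding q_def r_def by (simp add: m_assoc inv_mult_group)
  moreover have "y \<otimes> inv (q \<otimes> r) \<otimes> inv y \<in> N"
    by (rule N.inv_op_closed2) (use q r in auto)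
  ultimately show ?thesis by simp
qed

section \<open>The lower central series and commutators between its terms\<close>

lemma comm_subgroup_normal:
  assumes A: "A \<lhd> G" and B: "B \<lhd> G"
  shows "comm_subgroup G A B \<lhd> G"
  unfolding comm_subgroup_def
proof (rule normal_generateI)
  interpret A: normal A G by fact
  interpret B: normal B G by fact
  show "{commutator a b | a b. a \<in> A \<and> b \<in> B} \<subseteq> carrier G" by auto
  fix h g assume "h \<in> {commutator a b | a b. a \<in> A \<and> b \<in> B}" and g: "g \<in> carrier G"
  then obtain a b where h: "h = commutator a b" and a: "a \<in> A" and b: "b \<in> B" by auto
  have "g \<otimes> h \<otimes> inv g = commutator (g \<otimes> a \<otimes> inv g) (g \<otimes> b \<otimes> inv g)"
    using a b g by (simp add: h m_assoc inv_mult_group)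
  moreover have "g \<otimes> a \<otimes> inv g \<in> A" "g \<otimes> b \<otimes> inv g \<in> B"
    using a b g by (simp_all add: A.inv_op_closed2 B.inv_op_closed2)
  ultimately show "g \<otimes> h \<otimes> inv g \<in> {commutator a b | a b. a \<in> A \<and> b \<in> B}" by blast
qed

declare lower_central.simps(2) [simp del]

lemma lower_central_normal: "lower_central G i \<lhd> G"
  by (induction i) (simp_all add: lower_central.simps(2) normal_self comm_subgroup_normal)

lemma lower_central_in_carrier: "x \<in> lower_central G i \<Longrightarrow> x \<in> carrier G"
  using lower_central_normal normal_imp_subgroup subgroup.mem_carrier by metis

lemma commutator_lower_central_Suc:
  assumes "a \<in> lower_central G i" "g \<in> carrier G"
  shows "commutator a g \<in> lower_central G (Suc i)"
  using assms by (auto simp: lower_central.simps(2) comm_subgroup_def intro!: generate.incl)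

lemma commutator_lower_central_swap:
  assumes "a \<in> carrier G" "b \<in> carrier G" "commutator a b \<in> lower_central G i"
  shows "commutator b a \<in> lower_central G i"
proof -
  have "inv (commutator a b) \<in> lower_central G i"
    using assms lower_central_normal normal_imp_subgroup subgroup.m_inv_closed by metis
  moreover have "inv (commutator a b) = commutator b a"
    using assms by (simp add: m_assoc inv_mult_group)
  ultimately show ?thesis by simp
qed

lemma lower_central_Suc_subset: "lower_central G (Suc i) \<subseteq> lower_central G i"
proof -
  interpret L: normal "lower_central G i" G by (rule lower_central_normal)
  have "commutator a g \<in> lower_central G i"
    if "a \<in> lower_central G i" "g \<in> carrier G" for a g
    using subsetD[OF centralizer_mod_contains[OF lower_central_normal] that(1)] that(2)
    by (auto simp: centralizer_mod_def)
  then show ?thesis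
    unfolding lower_central.simps(2) comm_subgroup_def
    by (intro generate_subgroup_incl L.subgroup_axioms) blast
qed

lemma lower_central_antimono: "i \<le> j \<Longrightarrow> lower_central G j \<subseteq> lower_central G i"
  using lower_central_Suc_subset by (rule lift_Suc_antimono_le)

text \<open>In the usual numbering from 1 this is the inclusion of the commutator of the terms
  \<open>i + 1\<close> and \<open>j + 1\<close> in the term \<open>i + j + 2\<close>. In the
  induction on \<open>i\<close>, the Hall-Witt identity replaces the commutator of
  \<open>commutator a g\<close> with \<open>c\<close> by two others, to which the hypothesis applies
  with \<open>j\<close> and with \<open>Suc j\<close>.\<close>

lemma commutator_lower_central:
  assumes "a \<in> lower_central G i" "b \<in> lower_central G j"
  shows "commutator a b \<in> lower_central G (Suc (i + j))"
  using assms
proof (induction i arbitrary: a b j)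
  case 0
  then show ?case
    using commutator_lower_central_swap commutator_lower_central_Suc lower_central_in_carrier
    by (metis add_0 lower_central.simps(1))
next
  case (Suc i)
  let ?N = "lower_central G (Suc (Suc i + j))"
  have L: "inv x \<in> lower_central G k" if "x \<in> lower_central G k" for x k
    using that lower_central_normal normal_imp_subgroup subgroup.m_inv_closed by metis
  have "commutator (commutator a g) c \<in> ?N"
    if a: "a \<in> lower_central G i" and g: "g \<in> carrier G" and c: "c \<in> lower_central G j" for a g c
  proof -
    have aG: "a \<in> carrier G" and cG: "c \<in> carrier G"
      using a c lower_central_in_carrier by blast+
    have "commutator (inv c) (inv a) \<in> lower_central G (Suc (i + j))"
      by (rule commutator_lower_central_swap) (use Suc.IH[OF L[OF a] L[OF c]] aG cG in simp_all)
    then have 1: "commutator (commutator (inv c) (inv a)) (inv (inv g)) \<in> ?N"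
      using commutator_lower_central_Suc g by simp
    have u: "commutator (inv g) c \<in> lower_central G (Suc j)"
      using commutator_lower_central_Suc[OF c, of "inv g"] commutator_lower_central_swap g cG by blast
    then have "commutator (inv a) (commutator (inv g) c) \<in> ?N"
      using Suc.IH[OF L[OF a] u] by simp
    then have "commutator (commutator (inv g) c) (inv a) \<in> ?N"
      by (rule commutator_lower_central_swap[rotated 2]) (use aG cG g in simp_all)
    then have 2: "commutator (commutator (inv g) (inv (inv c))) (inv a) \<in> ?N" using cG by simp
    show ?thesis
      using three_subgroups_element[OF lower_central_normal, of "inv g" a "inv c", OF _ _ _ 1 2]
        aG cG g by simp
  qed
  \<comment> \<open>So far only generators of \<open>lower_central G (Suc i)\<close> are covered.
    The elements with the desired property form a subgroup, a relative centralizer, so the property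
    passes to the subgroup generated.\<close>
  then have "{commutator a g | a g. a \<in> lower_central G i \<and> g \<in> carrier G}
      \<subseteq> centralizer_mod ?N (lower_central G j)"
    using lower_central_in_carrier by (auto simp: centralizer_mod_def)
  moreover have "subgroup (centralizer_mod ?N (lower_central G j)) G"
    using lower_central_in_carrier by (intro subgroup_centralizer_mod lower_central_normal) blast
  ultimately have "lower_central G (Suc i) \<subseteq> centralizer_mod ?N (lower_central G j)"
    unfolding lower_central.simps(2)[of G i] comm_subgroup_def by (rule generate_subgroup_incl)
  then show ?case using Suc.prems by (auto simp: centralizer_mod_def)
qed

text \<open>Commutators within the term of index \<open>i\<close> lie in the term of index
  \<open>Suc (i + i)\<close>. Starting from 0 this recursion gives \<open>2 ^ d - 1\<close>, which
  is the term \<open>2 ^ d\<close> when counting from 1.\<close>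

lemma derived_series_subset_lower_central:
  "(derived G ^^ d) (carrier G) \<subseteq> lower_central G (2 ^ d - 1)"
proof (induction d)
  case 0
  then show ?case by simp
next
  case (Suc d)
  have "Suc ((2 ^ d - 1) + (2 ^ d - 1)) = 2 ^ Suc d - (1 :: nat)"
    using one_le_power[of "2 :: nat" d] unfolding power_Suc by linarith
  then have "derived_set G ((derived G ^^ d) (carrier G)) \<subseteq> lower_central G (2 ^ Suc d - 1)"
    using Suc.IH commutator_lower_central by fastforce
  then show ?case
    unfolding funpow.simps comp_apply derived_def[of G "(derived G ^^ d) (carrier G)"]
    by (rule generate_subgroup_incl) (rule normal_imp_subgroup[OF lower_central_normal])
qed

lemma lower_central_nilpotency_class:
  "lower_central G c = {\<one>} \<Longrightarrow> lower_central G (nilpotency_class G) = {\<one>}"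
  unfolding nilpotency_class_def by (rule LeastI)

text \<open>If the power exceeded the class, the derived series would already be trivial at index
  \<open>derived_length G - 1\<close>. This contradicts minimality unless
  \<open>derived_length G = 0\<close>, where the subtraction truncates; that case is excluded by
  \<open>carrier G \<noteq> {\<one>}\<close>.\<close>

lemma two_power_derived_length_le:
  assumes c: "lower_central G c = {\<one>}" and "carrier G \<noteq> {\<one>}"
  shows "2 ^ (derived_length G - 1) \<le> nilpotency_class G"
proof (rule ccontr)
  assume *: "\<not> 2 ^ (derived_length G - 1) \<le> nilpotency_class G"
  have L: "lower_central G (nilpotency_class G) = {\<one>}"
    using c by (rule lower_central_nilpotency_class)
  have "(derived G ^^ (derived_length G - 1)) (carrier G) \<subseteq> {\<one>}"
    using derived_series_subset_lower_central[of "derived_length G - 1"] L *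
      lower_central_antimono[of "nilpotency_class G" "2 ^ (derived_length G - 1) - 1"] by fastforce
  then have eq: "(derived G ^^ (derived_length G - 1)) (carrier G) = {\<one>}"
    using exp_of_derived_is_subgroup[OF subgroup_self] subgroup.one_closed by blast
  then have "derived_length G \<le> derived_length G - 1"
    by (subst derived_length_def) (rule Least_le)
  then have "derived_length G = 0" by simp
  with eq assms(2) show False by simp
qed

end

section \<open>Finite p-groups have nontrivial centre\<close>

locale finite_p_group = group G for G (structure) +
  fixes p :: nat
  assumes prime_p: "Factorial_Ring.prime p" and p_group: "p_group p G"

lemma finite_p_groupI_dvd:
  assumes "Factorial_Ring.prime p" "group H" "finite (carrier H)" "card (carrier H) dvd p ^ k"
  shows "finite_p_group H p"
  using assms divides_primepow_nat[of p "card (carrier H)" k]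
  by (auto simp: finite_p_group_def finite_p_group_axioms_def p_group_def)

context finite_p_group
begin

lemma finite_carrier [simp]: "finite (carrier G)"
  using p_group by (simp add: p_group_def)

lemma card_carrier: obtains k where "card (carrier G) = p ^ k"
  using p_group by (auto simp: p_group_def)

lemma p_gt_1: "p > 1"
  using prime_p by (rule prime_gt_1_nat)

lemma finite_subgroup: "subgroup H G \<Longrightarrow> finite H"
  using finite_carrier finite_subset subgroup.subset by metis

section \<open>Orders of subgroups and quotients, and the centre\<close>

lemma subgroup_finite_p_group:
  assumes "subgroup H G" shows "finite_p_group (G\<lparr>carrier := H\<rparr>) p"
proof -
  obtain k where "card (carrier G) = p ^ k" by (rule card_carrier)
  moreover have "card H dvd card (carrier G)"
    using lagrange[OF assms] by (metis dvd_triv_right order_def)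
  ultimately show ?thesis
    using assms finite_subgroup subgroup_imp_group prime_p
    by (intro finite_p_groupI_dvd[of p _ k]) auto
qed

lemma card_subgroup:
  assumes "subgroup H G" obtains k where "card H = p ^ k"
  using finite_p_group.card_carrier[OF subgroup_finite_p_group[OF assms]] by auto

lemma card_proper_subgroup:
  assumes H: "subgroup H G" and "H \<noteq> carrier G"
  shows "p * card H dvd card (carrier G)"
proof -
  obtain k where k: "card (carrier G) = p ^ k" by (rule card_carrier)
  obtain i where i: "card H = p ^ i" using H by (rule card_subgroup)
  have "H \<subset> carrier G" using assms subgroup.subset by blast
  then have "p ^ i < p ^ k" using k i by (metis finite_carrier psubset_card_mono)
  then have "Suc i \<le> k" using p_gt_1 by simp
  then show ?thesis unfolding i k by (metis le_imp_power_dvd power_Suc)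
qed

lemma card_psubset_subgroup:
  assumes "subgroup H G" "subgroup K G" "H \<subset> K"
  shows "p * card H dvd card K"
  using finite_p_group.card_proper_subgroup[OF subgroup_finite_p_group[OF assms(2)], of H]
    subgroup_incl[OF assms(1,2)] assms(3) by auto

lemma quotient_finite_p_group:
  assumes "K \<lhd> G" shows "finite_p_group (G Mod K) p"
proof -
  interpret K: normal K G by fact
  obtain k where "card (carrier G) = p ^ k" by (rule card_carrier)
  moreover have "card (carrier (G Mod K)) dvd card (carrier G)"
    using lagrange[OF K.subgroup_axioms]
    by (metis dvd_triv_left order_def FactGroup_def partial_object.select_convs(1))
  moreover have "finite (carrier (G Mod K))" by (simp add: carrier_FactGroup)
  ultimately show ?thesis
    using prime_p K.factorgroup_is_group by (intro finite_p_groupI_dvd[of p _ k]) auto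
qed

text \<open>This is the class equation. Orbits under conjugation have \<open>p\<close>-power size,
  and an orbit of size 1 consists of a central element. If \<open>\<one>\<close> were the only
  central element, all orbits but \<open>{\<one>}\<close> would have size divisible by
  \<open>p\<close>, and so \<open>p\<close> would divide 1.\<close>

lemma nontrivial_central_element:
  assumes "carrier G \<noteq> {\<one>}"
  obtains z where "z \<in> carrier G" "z \<noteq> \<one>" "\<And>g. g \<in> carrier G \<Longrightarrow> z \<otimes> g = g \<otimes> z"
proof -
  let ?\<phi> = "\<lambda>g. \<lambda>h \<in> carrier G. g \<otimes> h \<otimes> inv g"
  interpret A: group_action G "carrier G" ?\<phi> by (rule action_by_conjugation)
  obtain k where k: "card (carrier G) = p ^ k" by (rule card_carrier)
  have "k \<noteq> 0"
  proof
    assume "k = 0"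
    then obtain x where "carrier G = {x}" using k card_1_singletonE by (metis power_0)
    then show False using assms one_closed by auto
  qed
  have "\<exists>z \<in> carrier G. z \<noteq> \<one> \<and> (\<forall>g \<in> carrier G. z \<otimes> g = g \<otimes> z)"
  proof (rule ccontr)
    assume *: "\<not> ?thesis"
    let ?O = "orbits G (carrier G) ?\<phi>"
    have one: "orbit G ?\<phi> \<one> = {\<one>}" by (auto simp: orbit_def intro: exI[of _ \<one>])
    have div: "p dvd card A" if A: "A \<in> ?O - {{\<one>}}" for A
    proof -
      obtain x where x: "x \<in> carrier G" "A = orbit G ?\<phi> x"
        using A by (auto simp: orbits_def)
      have "card A * card (stabilizer G ?\<phi> x) = p ^ k"
        using A.orbit_stabilizer_theorem[OF x(1)] x(2) k by (simp add: order_def)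
      then have "card A dvd p ^ k" by (rule dvdI[OF sym])
      then obtain i where i: "card A = p ^ i"
        using divides_primepow_nat[OF prime_p] by blast
      have "i \<noteq> 0"
      proof
        assume "i = 0"
        then have "A = {x}"
          using i A.orbit_refl[OF x(1)] x(2) card_1_singletonE by (metis power_0 singletonD)
        then have "g \<otimes> x \<otimes> inv g = x" if "g \<in> carrier G" for g
          using that x by (auto simp: orbit_def)
        then have "x \<otimes> g = g \<otimes> x" if "g \<in> carrier G" for g
          using that x(1) by (metis inv_solve_right m_closed)
        moreover have "x \<noteq> \<one>" using A x(2) one by auto
        ultimately show False using * x(1) by blast
      qed
      then show ?thesis using i by simp
    qed
    have "finite ?O" by (simp add: orbits_def)
    have "{\<one>} \<in> ?O" using one unfolding orbits_def by blast
    have "card (carrier G) = (\<Sum>A\<in>?O. card A)"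
      using A.disjoint_sum[of "\<lambda>_. 1 :: nat"] by simp
    also have "\<dots> = 1 + (\<Sum>A\<in>?O - {{\<one>}}. card A)"
      using \<open>finite ?O\<close> \<open>{\<one>} \<in> ?O\<close> by (simp add: sum.remove)
    finally have "p ^ k = 1 + (\<Sum>A\<in>?O - {{\<one>}}. card A)" using k by simp
    moreover have "p dvd p ^ k" using \<open>k \<noteq> 0\<close> by simp
    ultimately have "p dvd 1 + (\<Sum>A\<in>?O - {{\<one>}}. card A)" by (rule subst)
    moreover have "p dvd (\<Sum>A\<in>?O - {{\<one>}}. card A)" using div by (rule dvd_sum)
    ultimately have "p dvd 1" by (simp only: dvd_add_left_iff)
    then show False using p_gt_1 by simp
  qed
  then show thesis using that by blast
qed

text \<open>A nontrivial central element of \<open>G Mod K\<close> is a coset of an element outside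
  \<open>K\<close> that commutes with everything modulo \<open>K\<close>.\<close>

lemma centralizer_mod_strict:
  assumes K: "K \<lhd> G" and ne: "K \<noteq> carrier G"
  shows "K \<subset> centralizer_mod K (carrier G)"
proof -
  interpret K: normal K G by fact
  interpret Q: finite_p_group "G Mod K" p using K by (rule quotient_finite_p_group)
  have "carrier (G Mod K) \<noteq> {\<one>\<^bsub>G Mod K\<^esub>}"
  proof
    assume *: "carrier (G Mod K) = {\<one>\<^bsub>G Mod K\<^esub>}"
    have "x \<in> K" if "x \<in> carrier G" for x
      using * that rcos_self[OF that K.subgroup_axioms] by (auto simp: carrier_FactGroup)
    then show False using ne K.subset by blast
  qed
  then obtain z where z: "z \<in> carrier (G Mod K)" "z \<noteq> K"
    and comm: "\<And>g. g \<in> carrier (G Mod K) \<Longrightarrow> z \<otimes>\<^bsub>G Mod K\<^esub> g = g \<otimes>\<^bsub>G Mod K\<^esub> z"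
    using Q.nontrivial_central_element by (metis one_FactGroup)
  obtain x where x: "x \<in> carrier G" "z = K #> x" using z(1) by (auto simp: carrier_FactGroup)
  have "x \<notin> K" using z(2) x K.rcos_const by blast
  have "commutator x g \<in> K" if g: "g \<in> carrier G" for g
  proof -
    have "K #> (x \<otimes> g) = K #> (g \<otimes> x)"
      using comm[of "K #> g"] x g by (auto simp: carrier_FactGroup K.rcos_sum)
    then have "x \<otimes> g \<in> K #> (g \<otimes> x)"
      using rcos_self[of "x \<otimes> g" K] x g K.subgroup_axioms by auto
    then have "x \<otimes> g \<otimes> inv (g \<otimes> x) \<in> K"
      using x g by (simp add: K.rcos_module)
    then show ?thesis using x g by (simp add: inv_mult_group m_assoc)
  qed
  then have "x \<in> centralizer_mod K (carrier G)" using x by (simp add: centralizer_mod_def)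
  then show ?thesis using centralizer_mod_contains[OF K] \<open>x \<notin> K\<close> by blast
qed

end

section \<open>The upper central series and normalizers\<close>

definition (in group) upper_central :: "nat \<Rightarrow> 'a set"
  where "upper_central i = ((\<lambda>K. centralizer_mod K (carrier G)) ^^ i) {\<one>}"

lemma (in group) upper_central_simps [simp]:
  "upper_central 0 = {\<one>}"
  "upper_central (Suc i) = centralizer_mod (upper_central i) (carrier G)"
  by (simp_all add: upper_central_def)

lemma (in group) upper_central_normal: "upper_central i \<lhd> G"
  by (induction i) (simp_all add: one_is_normal normal_centralizer_mod)

text \<open>Taking commutators with \<open>G\<close> descends at least one step in the upper central
  series. At \<open>i = m\<close> the length of the upper series thus bounds the class.\<close>

lemma (in group) lower_central_subset_upper_central:
  assumes "upper_central m = carrier G" "i \<le> m"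
  shows "lower_central G i \<subseteq> upper_central (m - i)"
  using assms(2)
proof (induction i)
  case 0
  then show ?case using assms(1) by simp
next
  case (Suc i)
  then have "lower_central G i \<subseteq> upper_central (Suc (m - Suc i))"
    by (simp add: Suc_diff_Suc del: upper_central_simps)
  then have "{commutator a g | a g. a \<in> lower_central G i \<and> g \<in> carrier G}
      \<subseteq> upper_central (m - Suc i)"
    by (auto simp: centralizer_mod_def)
  then show ?case
    unfolding lower_central.simps(2) comm_subgroup_def
    by (rule generate_subgroup_incl) (rule normal_imp_subgroup[OF upper_central_normal])
qed

text \<open>An injective map of a finite set into itself is onto, so inclusion of the conjugate in
  \<open>H\<close> already gives equality.\<close>

lemma (in group) normalizer_memI:
  assumes fin: "finite (carrier G)" and H: "H \<subseteq> carrier G" and x: "x \<in> carrier G"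
    and conj: "\<And>h. h \<in> H \<Longrightarrow> x \<otimes> h \<otimes> inv x \<in> H"
  shows "x \<in> normalizer G H"
proof -
  have "(\<lambda>h. x \<otimes> h \<otimes> inv x) ` H = H"
  proof (rule endo_inj_surj)
    show "finite H" using fin H by (rule rev_finite_subset)
    show "inj_on (\<lambda>h. x \<otimes> h \<otimes> inv x) H"
      using H x by (auto simp: inj_on_def subset_iff)
  qed (use conj in auto)
  moreover have "x <# H #> inv x = (\<lambda>h. x \<otimes> h \<otimes> inv x) ` H"
    by (auto simp: l_coset_def r_coset_def)
  ultimately show ?thesis using H x by (simp add: normalizer_def stabilizer_def)
qed

section \<open>Growth of the upper central series and of normalizers; overgroups of relative index
  \<open>p\<close>\<close>

context finite_p_group
begin

lemma card_upper_central: "upper_central i = carrier G \<or> p ^ i \<le> card (upper_central i)"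
proof (induction i)
  case 0
  then show ?case by simp
next
  case (Suc i)
  let ?U = "upper_central i"
  show ?case
  proof (cases "?U = carrier G")
    case True
    then have "upper_central (Suc i) = carrier G"
      using centralizer_mod_contains[OF upper_central_normal[of i]]
      by (auto simp: centralizer_mod_def)
    then show ?thesis ..
  next
    case False
    have "?U \<subset> upper_central (Suc i)"
      using centralizer_mod_strict[OF upper_central_normal False] by simp
    then have "p * card ?U dvd card (upper_central (Suc i))"
      by (intro card_psubset_subgroup normal_imp_subgroup upper_central_normal)
    moreover have "card (upper_central (Suc i)) > 0"
      using normal_imp_subgroup[OF upper_central_normal[of "Suc i"]] finite_carrier
      by (rule subgroup.finite_imp_card_positive)
    ultimately have "p * card ?U \<le> card (upper_central (Suc i))" by (rule dvd_imp_le)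
    moreover have "p * p ^ i \<le> p * card ?U" using Suc False by simp
    ultimately have "p ^ Suc i \<le> card (upper_central (Suc i))"
      unfolding power_Suc by (rule le_trans[rotated])
    then show ?thesis ..
  qed
qed

lemma ex_upper_central_eq_carrier: "\<exists>m. upper_central m = carrier G"
proof -
  obtain k where k: "card (carrier G) = p ^ k" by (rule card_carrier)
  \<comment> \<open>After \<open>Suc k\<close> steps a series that had not reached \<open>G\<close>
    would have a term of order at least \<open>p ^ Suc k\<close>, more than the order of
    \<open>G\<close>.\<close>
  have "upper_central (Suc k) \<subseteq> carrier G"
    by (intro subgroup.subset normal_imp_subgroup upper_central_normal)
  then have "card (upper_central (Suc k)) \<le> p ^ k"
    using k finite_carrier by (metis card_mono)
  moreover have "p ^ k < p ^ Suc k" using p_gt_1 by simp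
  ultimately show ?thesis using card_upper_central[of "Suc k"] by (metis le_trans not_le)
qed

text \<open>Elements of the first upper central term not contained in \<open>H\<close> commute with
  \<open>H\<close> modulo the preceding term. That term lies in \<open>H\<close>, so these elements
  normalize \<open>H\<close>.\<close>

lemma normalizer_strict:
  assumes H: "subgroup H G" and ne: "H \<noteq> carrier G"
  shows "H \<subset> normalizer G H"
proof -
  interpret H: subgroup H G by fact
  obtain m where "upper_central m = carrier G" using ex_upper_central_eq_carrier by blast
  then have m: "\<not> upper_central m \<subseteq> H" using ne H.subset by auto
  define i where "i = (LEAST i. \<not> upper_central i \<subseteq> H)"
  have i: "\<not> upper_central i \<subseteq> H" unfolding i_def using m by (rule LeastI)
  have "i \<noteq> 0" using i H.one_closed by (intro notI) simp
  then obtain j where j: "i = Suc j" using not0_implies_Suc by blast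
  then have jH: "upper_central j \<subseteq> H"
    using not_less_Least[of j "\<lambda>i. \<not> upper_central i \<subseteq> H"] by (auto simp: i_def)
  obtain x where x: "x \<in> upper_central (Suc j)" "x \<notin> H" using i j by blast
  then have xG: "x \<in> carrier G" by (simp add: centralizer_mod_def)
  have "x \<in> normalizer G H"
  proof (rule normalizer_memI)
    fix h assume h: "h \<in> H"
    have "commutator x h \<in> H" using x(1) h jH by (auto simp: centralizer_mod_def)
    then have "commutator x h \<otimes> h \<in> H" using h by (rule H.m_closed)
    moreover have "commutator x h \<otimes> h = x \<otimes> h \<otimes> inv x" using xG h by (simp add: m_assoc)
    ultimately show "x \<otimes> h \<otimes> inv x \<in> H" by simp
  qed (use xG H.subset in auto)
  moreover have "H \<subseteq> normalizer G H"
    using subgroup.subset[OF normal_imp_subgroup[OF subgroup_in_normalizer[OF H]]] by simp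
  ultimately show ?thesis using x(2) by blast
qed

text \<open>The quotient of the normalizer by \<open>H\<close> is a nontrivial
  \<open>p\<close>-group. It has a subgroup \<open>S\<close> of order \<open>p\<close>, whose
  preimage is \<open>\<Union>S\<close>.\<close>

lemma ex_overgroup:
  assumes H: "subgroup H G" and ne: "H \<noteq> carrier G"
  obtains K where "subgroup K G" "H \<subseteq> K" "card K = p * card H"
proof -
  let ?N = "normalizer G H"
  let ?GN = "G\<lparr>carrier := ?N\<rparr>"
  have N: "subgroup ?N G" by (intro normalizer_imp_subgroup subgroup.subset H)
  interpret N: finite_p_group ?GN p using N by (rule subgroup_finite_p_group)
  interpret HN: normal H ?GN using H by (rule subgroup_in_normalizer)
  interpret Q: finite_p_group "?GN Mod H" p using HN.normal_axioms by (rule N.quotient_finite_p_group)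
  have card_N: "order (?GN Mod H) * card H = card ?N"
    using N.lagrange[OF HN.subgroup_axioms] by (simp add: order_def FactGroup_def)
  have "card H < card ?N"
    using normalizer_strict[OF H ne] finite_subgroup[OF N] by (rule psubset_card_mono[rotated])
  then have "order (?GN Mod H) \<noteq> 1" using card_N by auto
  moreover obtain k where "order (?GN Mod H) = p ^ k"
    using Q.card_carrier unfolding order_def by blast
  \<comment> \<open>Sylow's theorem in the form used here gives a subgroup of order
    \<open>p ^ a\<close> for any factorization \<open>p ^ a * m\<close> of the order. It is applied
    with \<open>a = 1\<close>, where \<open>p\<close> may still divide \<open>m\<close>.\<close>
  ultimately obtain m where "order (?GN Mod H) = p ^ 1 * m"
    by (cases k) auto
  then obtain S where S: "subgroup S (?GN Mod H)" "card S = p"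
    using sylow_thm[OF prime_p Q.is_group _ Q.finite_carrier, of 1 m] by auto
  have "subgroup (\<Union>S) ?GN" using S(1) by (rule HN.factgroup_subgroup_union_subgroup)
  then have K: "subgroup (\<Union>S) G" using N incl_subgroup by blast
  have HS: "H \<in> S" using subgroup.one_closed[OF S(1)] by simp
  have SR: "S \<subseteq> rcosets\<^bsub>?GN\<^esub> H" using subgroup.subset[OF S(1)] by (simp add: FactGroup_def)
  have "card H * card S = card (\<Union>S)"
  proof (rule card_partition)
    show "finite S" using Q.finite_subgroup S(1) by blast
    show "finite (\<Union>S)" using K by (rule finite_subgroup)
    show "card c = card H" if "c \<in> S" for c
      using that SR N.card_rcosets_equal[of c H] HN.subset by auto
    show "c1 \<inter> c2 = {}" if "c1 \<in> S" "c2 \<in> S" "c1 \<noteq> c2" for c1 c2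
      using that SR N.rcos_disjoint[OF HN.subgroup_axioms] pairwiseD[of disjnt]
      unfolding disjnt_def by blast
  qed
  then show thesis using that[OF K] HS S(2) by (simp add: Sup_upper mult.commute)
qed

text \<open>The overgroup is built inside \<open>?C\<close>, the preimage of the centre of
  \<open>G Mod K\<close>; there every subgroup above \<open>K\<close> is normal in
  \<open>G\<close>.\<close>

lemma ex_normal_overgroup:
  assumes K: "K \<lhd> G" and ne: "K \<noteq> carrier G"
  obtains L where "L \<lhd> G" "card L = p * card K"
proof -
  let ?C = "centralizer_mod K (carrier G)"
  have C: "subgroup ?C G" using K by (rule subgroup_centralizer_mod) simp
  interpret C: finite_p_group "G\<lparr>carrier := ?C\<rparr>" p using C by (rule subgroup_finite_p_group)
  have "subgroup K (G\<lparr>carrier := ?C\<rparr>)"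
    using normal_imp_subgroup[OF K] C centralizer_mod_contains[OF K] by (rule subgroup_incl)
  moreover have "K \<noteq> carrier (G\<lparr>carrier := ?C\<rparr>)"
    using centralizer_mod_strict[OF K ne] by auto
  ultimately obtain L where L: "subgroup L (G\<lparr>carrier := ?C\<rparr>)" "K \<subseteq> L" "card L = p * card K"
    by (rule C.ex_overgroup)
  have "subgroup L G" using C L(1) by (rule incl_subgroup)
  moreover have "L \<subseteq> ?C" using subgroup.subset[OF L(1)] by simp
  ultimately have "L \<lhd> G" using K L(2) normal_between_centralizer_mod by blast
  then show thesis using that L(3) by blast
qed

lemma ex_normal_of_card:
  assumes "card (carrier G) = p ^ k" "i \<le> k"
  shows "\<exists>N. N \<lhd> G \<and> card N = p ^ i"
  using assms(2)
proof (induction i)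
  case 0
  then show ?case using one_is_normal by (intro exI[of _ "{\<one>}"]) simp
next
  case (Suc i)
  then obtain N where N: "N \<lhd> G" "card N = p ^ i" by auto
  have "N \<noteq> carrier G"
  proof
    assume "N = carrier G"
    then have "p ^ i = p ^ k" using N(2) assms(1) by simp
    then show False using Suc.prems p_gt_1 by simp
  qed
  with N(1) obtain L where "L \<lhd> G" "card L = p * card N" by (rule ex_normal_overgroup)
  then show ?case using N(2) by (intro exI[of _ L]) simp
qed

text \<open>Repeatedly enlarging \<open>H\<close> by a factor \<open>p\<close> ends at
  \<open>G\<close>; the last subgroup before that has index \<open>p\<close>.\<close>

lemma ex_index_p_overgroup:
  assumes "subgroup H G" "H \<noteq> carrier G"
  shows "\<exists>M. subgroup M G \<and> H \<subseteq> M \<and> card (carrier G) = p * card M"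
  using assms
proof (induction "card (carrier G) - card H" arbitrary: H rule: less_induct)
  case less
  obtain K where K: "subgroup K G" "H \<subseteq> K" "card K = p * card H"
    using less.prems by (rule ex_overgroup)
  show ?case
  proof (cases "K = carrier G")
    case True
    then show ?thesis using less.prems(1) K(3) by (intro exI[of _ H]) simp
  next
    case False
    have "card H > 0" using less.prems(1) finite_carrier by (rule subgroup.finite_imp_card_positive)
    then have "card H < card K" using K(3) p_gt_1 by simp
    moreover have "card K < card (carrier G)"
      using False subgroup.subset[OF K(1)] by (intro psubset_card_mono) auto
    ultimately have "card (carrier G) - card K < card (carrier G) - card H" by simp
    then obtain M where "subgroup M G" "K \<subseteq> M" "card (carrier G) = p * card M"
      using less.hyps[of K] K(1) False by blast
    then show ?thesis using K(2) by blast
  qed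
qed

text \<open>The normalizer is strictly larger than \<open>M\<close>, so its order is at least
  \<open>p * card M\<close>, which is the order of \<open>G\<close>.\<close>

lemma index_p_normal:
  assumes M: "subgroup M G" and card: "card (carrier G) = p * card M"
  shows "M \<lhd> G"
proof -
  have pos: "card M > 0" using M finite_carrier by (rule subgroup.finite_imp_card_positive)
  have ne: "M \<noteq> carrier G"
  proof
    assume "M = carrier G"
    with card have "card M = p * card M" by metis
    then show False using pos p_gt_1 by simp
  qed
  have N: "subgroup (normalizer G M) G" by (intro normalizer_imp_subgroup subgroup.subset M)
  have "card (carrier G) dvd card (normalizer G M)"
    unfolding card using M N normalizer_strict[OF M ne] by (rule card_psubset_subgroup)
  then have "card (carrier G) \<le> card (normalizer G M)"
    using subgroup.finite_imp_card_positive[OF N finite_carrier] by (rule dvd_imp_le)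
  then have "normalizer G M = carrier G"
    using subgroup.subset[OF N] by (simp add: card_seteq)
  then show ?thesis using subgroup_in_normalizer[OF M] by simp
qed

lemma pow_p_in_index_p:
  assumes M: "subgroup M G" and card: "card (carrier G) = p * card M" and x: "x \<in> carrier G"
  shows "x [^] p \<in> M"
proof -
  interpret M: normal M G using M card by (rule index_p_normal)
  interpret Q: finite_p_group "G Mod M" p using M.normal_axioms by (rule quotient_finite_p_group)
  have pos: "card M > 0" using M finite_carrier by (rule subgroup.finite_imp_card_positive)
  have "order (G Mod M) * card M = p * card M"
    using lagrange[OF M] card by (simp add: order_def FactGroup_def)
  then have "order (G Mod M) = p" using pos by simp
  moreover have "M #> x \<in> carrier (G Mod M)" using x by (simp add: carrier_FactGroup)
  ultimately have "(M #> x) [^]\<^bsub>G Mod M\<^esub> p = M"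
    using Q.pow_order_eq_1[of "M #> x"] by simp
  then have "M #> (x [^] p) = M" using M.FactGroup_pow[OF x] by simp
  then show ?thesis using rcos_self[OF nat_pow_closed[OF x, of p] M] by simp
qed

end

section \<open>Subgroups of index p\<close>

context group
begin

lemma cyclic_group_iff_generate:
  "cyclic_group G \<longleftrightarrow> (\<exists>a\<in>carrier G. carrier G = generate G {a})"
  by (auto simp: cyclic_group generate_pow full_SetCompr_eq)

lemma generate_singleton_comm:
  assumes "b \<in> carrier G" "u \<in> generate G {b}" "v \<in> generate G {b}"
  shows "u \<otimes> v = v \<otimes> u"
proof -
  obtain i j :: int where "u = b [^] i" "v = b [^] j"
    using assms by (auto simp: generate_pow)
  then show ?thesis using assms(1) by (simp flip: int_pow_mult add: add.commute)
qed

lemma pow_mult_commute: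
  fixes n :: nat
  assumes [simp]: "a \<in> carrier G" "y \<in> carrier G" "c \<in> carrier G"
    and ya: "y \<otimes> a = a \<otimes> y \<otimes> c" and ca: "c \<otimes> a = a \<otimes> c" and cy: "c \<otimes> y = y \<otimes> c"
  shows "y [^] n \<otimes> a = a \<otimes> y [^] n \<otimes> c [^] n"
    and "y \<otimes> a [^] n = a [^] n \<otimes> y \<otimes> c [^] n"
proof -
  have cny: "c [^] m \<otimes> y = y \<otimes> c [^] m" and cna: "c [^] m \<otimes> a = a \<otimes> c [^] m" for m :: nat
    using ca cy by (simp_all add: group_commutes_pow)
  show "y [^] n \<otimes> a = a \<otimes> y [^] n \<otimes> c [^] n"
  proof (induction n)
    case (Suc n)
    have "y [^] Suc n \<otimes> a = y [^] n \<otimes> a \<otimes> (y \<otimes> c)" by (simp add: m_assoc ya)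
    also have "\<dots> = a \<otimes> y [^] n \<otimes> (c [^] n \<otimes> y) \<otimes> c" by (simp add: Suc m_assoc)
    also have "\<dots> = a \<otimes> y [^] Suc n \<otimes> c [^] Suc n" by (simp add: cny m_assoc)
    finally show ?case .
  qed simp
  show "y \<otimes> a [^] n = a [^] n \<otimes> y \<otimes> c [^] n"
  proof (induction n)
    case (Suc n)
    have "y \<otimes> a [^] Suc n = y \<otimes> a [^] n \<otimes> a" by (simp add: m_assoc)
    also have "\<dots> = a [^] n \<otimes> y \<otimes> (c [^] n \<otimes> a)" by (simp add: Suc m_assoc)
    also have "\<dots> = a [^] n \<otimes> (y \<otimes> a) \<otimes> c [^] n" by (simp add: cna m_assoc)
    also have "\<dots> = a [^] Suc n \<otimes> y \<otimes> (c \<otimes> c [^] n)" by (simp add: ya m_assoc)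
    also have "c \<otimes> c [^] n = c [^] Suc n" by (simp add: nat_pow_Suc2[symmetric] del: nat_pow_Suc)
    finally show ?case .
  qed simp
qed

text \<open>Collecting every \<open>a\<close> on the left exchanges one \<open>y\<close> with one
  \<open>a\<close> for each pair of factors, hence the exponent \<open>n choose 2\<close> of
  \<open>c\<close>.\<close>

lemma pow_mult_class_two:
  fixes n :: nat
  assumes [simp]: "a \<in> carrier G" "y \<in> carrier G" "c \<in> carrier G"
    and ya: "y \<otimes> a = a \<otimes> y \<otimes> c" and ca: "c \<otimes> a = a \<otimes> c" and cy: "c \<otimes> y = y \<otimes> c"
  shows "(a \<otimes> y) [^] n = a [^] n \<otimes> y [^] n \<otimes> c [^] (n choose 2)"
proof (induction n)
  case (Suc n)
  have cny: "c [^] m \<otimes> y = y \<otimes> c [^] m" and cna: "c [^] m \<otimes> a = a \<otimes> c [^] m" for m :: nat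
    using ca cy by (simp_all add: group_commutes_pow)
  have cnyw: "c [^] m \<otimes> (y \<otimes> w) = y \<otimes> (c [^] m \<otimes> w)" if "w \<in> carrier G" for m :: nat and w
    using that cny by (simp flip: m_assoc)
  have ch: "Suc n choose 2 = n + (n choose 2)"
    by (metis One_nat_def Suc_1 binomial_Suc_Suc choose_one)
  have "(a \<otimes> y) [^] Suc n = a [^] n \<otimes> y [^] n \<otimes> (c [^] (n choose 2) \<otimes> a) \<otimes> y"
    by (simp add: Suc m_assoc)
  also have "\<dots> = a [^] n \<otimes> (y [^] n \<otimes> a) \<otimes> (c [^] (n choose 2) \<otimes> y)"
    by (simp add: cna m_assoc)
  also have "\<dots> = a [^] Suc n \<otimes> y [^] n \<otimes> (c [^] n \<otimes> y) \<otimes> c [^] (n choose 2)"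
    by (simp add: pow_mult_commute(1)[OF assms] cny cnyw m_assoc)
  also have "\<dots> = a [^] Suc n \<otimes> y [^] Suc n \<otimes> (c [^] n \<otimes> c [^] (n choose 2))"
    by (simp add: cny cnyw m_assoc)
  also have "\<dots> = a [^] Suc n \<otimes> y [^] Suc n \<otimes> c [^] (Suc n choose 2)"
    by (simp add: nat_pow_mult ch)
  finally show ?case .
qed (simp add: numeral_2_eq_2)

end

text \<open>The square makes the divisibility hold for \<open>p = 2\<close> as well, whereas
  \<open>2 choose 2 = 1\<close> is odd. This lets the construction below treat all primes
  alike.\<close>

lemma dvd_square_choose_two: "p dvd (p ^ 2 choose 2)" for p :: nat
proof -
  have "2 dvd p * (p ^ 2 - 1)" by (cases "even p") auto
  then have "p ^ 2 choose 2 = p * (p * (p ^ 2 - 1) div 2)"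
    by (simp add: choose_two div_mult_swap power2_eq_square mult.assoc)
  then show ?thesis by simp
qed

section \<open>Several subgroups of index \<open>p\<close>, and a noncyclic one\<close>

context finite_p_group
begin

definition index_p :: "'a set \<Rightarrow> bool"
  where "index_p M \<longleftrightarrow> subgroup M G \<and> card (carrier G) = p * card M"

lemma ex_index_p_containing:
  assumes "\<not> cyclic_group G" "x \<in> carrier G"
  obtains M where "index_p M" "x \<in> M"
proof -
  have "subgroup (generate G {x}) G" using assms by (simp add: generate_is_subgroup)
  moreover have "generate G {x} \<noteq> carrier G"
    using assms by (auto simp: cyclic_group_iff_generate)
  ultimately obtain M where "subgroup M G" "generate G {x} \<subseteq> M" "card (carrier G) = p * card M"
    using ex_index_p_overgroup by blast
  moreover have "x \<in> generate G {x}" by (rule generate.incl) simp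
  ultimately show thesis using that[of M] by (auto simp: index_p_def)
qed

lemma index_p_incomparable:
  assumes "index_p M" "index_p N" "M \<noteq> N"
  obtains x where "x \<in> M" "x \<notin> N"
proof -
  have "p * card M = p * card N" using assms by (simp add: index_p_def)
  then have "card M = card N" using p_gt_1 by simp
  moreover have "finite N" using assms finite_subgroup by (auto simp: index_p_def)
  ultimately have "\<not> M \<subseteq> N" using assms(3) card_subset_eq by blast
  then show thesis using that by blast
qed

text \<open>With \<open>x\<close> in \<open>M\<close> outside \<open>L\<close> and \<open>u\<close>
  in \<open>L\<close> outside \<open>M\<close>, the product \<open>u \<otimes> x\<close> lies in
  neither. A subgroup of index \<open>p\<close> containing it is therefore a third one; it exists
  because one element does not generate \<open>G\<close>.\<close>

lemma ex_three_index_p: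
  assumes "\<not> cyclic_group G"
  obtains L M N where "index_p L" "index_p M" "index_p N" "L \<noteq> M" "L \<noteq> N" "M \<noteq> N"
proof -
  obtain L where L: "index_p L" using ex_index_p_containing[OF assms one_closed] by blast
  then have sL: "subgroup L G" by (simp add: index_p_def)
  have "card L > 0" using sL finite_carrier by (rule subgroup.finite_imp_card_positive)
  then have "card L < card (carrier G)" using L p_gt_1 by (simp add: index_p_def)
  then obtain x where x: "x \<in> carrier G" "x \<notin> L"
    using subgroup.subset[OF sL] by (metis subsetI subset_antisym less_irrefl)
  obtain M where M: "index_p M" "x \<in> M" using assms x(1) by (rule ex_index_p_containing)
  then have sM: "subgroup M G" by (simp add: index_p_def)
  have LM: "L \<noteq> M" using x M by blast
  obtain u where u: "u \<in> L" "u \<notin> M" using L M(1) LM by (rule index_p_incomparable)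
  have uG: "u \<in> carrier G" using sL u(1) by (rule subgroup.mem_carrier)
  have "u \<otimes> x \<notin> L"
  proof
    assume "u \<otimes> x \<in> L"
    then have "inv u \<otimes> (u \<otimes> x) \<in> L" using sL u(1) by (meson subgroup.m_closed subgroup.m_inv_closed)
    then show False using uG x by simp
  qed
  moreover have "u \<otimes> x \<notin> M"
  proof
    assume "u \<otimes> x \<in> M"
    then have "u \<otimes> x \<otimes> inv x \<in> M" using sM M(2) by (meson subgroup.m_closed subgroup.m_inv_closed)
    then show False using uG x u(2) by (simp add: m_assoc)
  qed
  moreover obtain N where "index_p N" "u \<otimes> x \<in> N"
    using assms m_closed[OF uG x(1)] by (rule ex_index_p_containing)
  ultimately show thesis using that[OF L M(1)] LM by blast
qed

text \<open>If all subgroups of index \<open>p\<close> are cyclic, two of them, generated by \<open>a\<close> and \<open>b\<close>, satisfy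
  \<open>a\<^sup>p = b\<^sup>p\<^sup>j\<close>. The element \<open>x = a b\<^sup>-\<^sup>j\<close> has order dividing \<open>p\<^sup>2\<close>, so that in a cyclic subgroup of
  order at least \<open>p\<^sup>3\<close> it is a \<open>p\<close>-th power and lies in every subgroup of index \<open>p\<close>.\<close>

lemma ex_noncyclic_index_p:
  assumes nc: "\<not> cyclic_group G" and k: "card (carrier G) = p ^ k" "k \<ge> 4"
  shows "\<exists>M. index_p M \<and> \<not> cyclic_group (G\<lparr>carrier := M\<rparr>)"
proof (rule ccontr)
  assume "\<not> ?thesis"
  then have allc: "cyclic_group (G\<lparr>carrier := M\<rparr>)" if "index_p M" for M
    using that by blast
  have pp: "p > 0" using p_gt_1 by simp
  have gen: "\<exists>a\<in>carrier G. M = {a [^] n | n. n \<in> (UNIV :: nat set)} \<and> M = generate G {a} \<and> ord a = p ^ (k - 1)"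
    if M: "index_p M" for M
  proof -
    have sM: "subgroup M G" using M by (simp add: index_p_def)
    interpret M: group "G\<lparr>carrier := M\<rparr>" using sM by (rule subgroup_imp_group)
    obtain a where a: "a \<in> M" "M = generate (G\<lparr>carrier := M\<rparr>) {a}"
      using allc[OF M] by (auto simp: M.cyclic_group_iff_generate)
    then have g: "M = generate G {a}" using generate_consistent[OF _ sM, of "{a}"] by simp
    have aG: "a \<in> carrier G" using sM a(1) by (rule subgroup.mem_carrier)
    have "p * card M = p ^ k" using M unfolding index_p_def k(1) by simp
    also have "\<dots> = p * p ^ (k - 1)" using k(2) by (simp flip: power_Suc)
    finally have "card M = p ^ (k - 1)" using pp by simp
    then have "ord a = p ^ (k - 1)" using generate_pow_card[OF aG] g by metis
    moreover have "M = {a [^] n | n. n \<in> (UNIV :: nat set)}"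
      using g generate_pow_on_finite_carrier[OF finite_carrier aG] by (rule trans)
    ultimately show ?thesis using g aG by blast
  qed
  obtain A B where AB: "index_p A" "index_p B" "A \<noteq> B" using ex_three_index_p[OF nc] by blast
  obtain a where a: "a \<in> carrier G" "A = {a [^] n | n. n \<in> (UNIV :: nat set)}" "A = generate G {a}"
      "ord a = p ^ (k - 1)"
    using gen[OF AB(1)] by blast
  obtain b where b: "b \<in> carrier G" "B = {b [^] n | n. n \<in> (UNIV :: nat set)}" "B = generate G {b}"
      "ord b = p ^ (k - 1)"
    using gen[OF AB(2)] by blast
  interpret A: normal A G using AB(1) by (auto simp: index_p_def intro: index_p_normal)
  interpret B: normal B G using AB(2) by (auto simp: index_p_def intro: index_p_normal)
  have powB: "x [^] p \<in> B" if "x \<in> carrier G" for x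
    using AB(2) that by (auto simp: index_p_def intro: pow_p_in_index_p)
  have aA: "a \<in> A" using a(3) by (simp add: generate.incl)
  have bB: "b \<in> B" using b(3) by (simp add: generate.incl)
  have aB: "a \<notin> B"
  proof
    assume "a \<in> B"
    then have "A \<subseteq> B" unfolding a(3) by (intro generate_subgroup_incl B.subgroup_axioms) simp
    then show False using index_p_incomparable[OF AB] by blast
  qed
  have Acomm: "u \<otimes> v = v \<otimes> u" if "u \<in> A" "v \<in> A" for u v
    using generate_singleton_comm[OF a(1)] that a(3) by blast
  have Bcomm: "u \<otimes> v = v \<otimes> u" if "u \<in> B" "v \<in> B" for u v
    using generate_singleton_comm[OF b(1)] that b(3) by blast
  have k1: "p ^ (k - 1) = p * p ^ (k - 2)"
  proof -
    have "k - 1 = Suc (k - 2)" using k(2) by simp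
    then show ?thesis by simp
  qed
  have "a [^] p \<in> B" using powB a(1) .
  then obtain m :: nat where m: "a [^] p = b [^] m" using b(2) by blast
  \<comment> \<open>Orders are compared: the power vanishes because
    \<open>ord a = p ^ (k - 1)\<close>, and as \<open>b\<close> has the same order, \<open>p\<close>
    must divide \<open>m\<close>.\<close>
  have "b [^] (m * p ^ (k - 2)) = (a [^] p) [^] (p ^ (k - 2))"
    using b(1) by (simp add: m nat_pow_pow)
  also have "\<dots> = a [^] ord a" using a(1) unfolding a(4) k1 by (simp add: nat_pow_pow)
  finally have "b [^] (m * p ^ (k - 2)) = \<one>" using a(1) by simp
  then have "p * p ^ (k - 2) dvd m * p ^ (k - 2)" using b(1,4) k1 by (simp add: pow_eq_id)
  then have "p dvd m" using pp by simp
  then obtain j where j: "m = p * j" by blast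
  define y where "y = inv (b [^] j)"
  have yB: "y \<in> B" unfolding y_def using b(2) by (intro B.m_inv_closed) blast
  have yG: "y \<in> carrier G" using yB by simp
  \<comment> \<open>This commutator lies in both normal subgroups \<open>A\<close> and
    \<open>B\<close>. They are abelian, so \<open>c\<close> commutes with \<open>a\<close> and with
    \<open>y\<close>, and the power formulas apply.\<close>
  define c where "c = inv y \<otimes> inv a \<otimes> y \<otimes> a"
  have cA: "c \<in> A"
    unfolding c_def using A.inv_op_closed1[OF yG A.m_inv_closed[OF aA]] aA by (rule A.m_closed)
  have cB: "c \<in> B"
  proof -
    have "inv y \<otimes> (inv a \<otimes> y \<otimes> a) \<in> B"
      using B.m_inv_closed[OF yB] B.inv_op_closed1[OF a(1) yB] by (rule B.m_closed)
    then show ?thesis using a(1) yG by (simp add: c_def m_assoc)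
  qed
  have cG: "c \<in> carrier G" using cA by simp
  have rel: "y \<otimes> a = a \<otimes> y \<otimes> c" using a(1) yG by (simp add: c_def m_assoc)
  note hyps = a(1) yG cG rel Acomm[OF cA aA] Bcomm[OF cB yB]
  \<comment> \<open>Since \<open>a [^] p\<close> lies in the abelian group \<open>B\<close>, it
    commutes with \<open>y\<close>; comparison with the power formula leaves
    \<open>c [^] p = \<one>\<close>.\<close>
  have "a [^] p \<otimes> y \<otimes> c [^] p = a [^] p \<otimes> y \<otimes> \<one>"
    using pow_mult_commute(2)[OF hyps, of p] Bcomm[OF yB powB[OF a(1)]] a(1) yG by simp
  then have cp: "c [^] p = \<one>" using a(1) yG cG by (simp del: r_one)
  define x where "x = a \<otimes> y"
  have xG: "x \<in> carrier G" using a(1) yG by (simp add: x_def)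
  have xB: "x \<notin> B"
  proof
    assume "x \<in> B"
    then have "x \<otimes> inv y \<in> B" using yB by simp
    then show False using aB a(1) yG by (simp add: x_def m_assoc)
  qed
  have "x [^] (p ^ 2) = a [^] (p ^ 2) \<otimes> y [^] (p ^ 2) \<otimes> c [^] (p ^ 2 choose 2)"
    unfolding x_def by (rule pow_mult_class_two[OF hyps])
  moreover obtain t where "p ^ 2 choose 2 = p * t" using dvd_square_choose_two by blast
  then have "c [^] (p ^ 2 choose 2) = \<one>" using cG cp by (simp flip: nat_pow_pow)
  moreover have "a [^] (p ^ 2) = (b [^] m) [^] p"
    using a(1) by (simp add: m[symmetric] nat_pow_pow power2_eq_square)
  then have "a [^] (p ^ 2) = b [^] (j * p ^ 2)"
    using b(1) by (simp add: nat_pow_pow j power2_eq_square mult.commute mult.left_commute)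
  moreover have "y [^] (p ^ 2) = inv (b [^] (j * p ^ 2))"
    using b(1) by (simp add: y_def nat_pow_inv nat_pow_pow)
  ultimately have xp: "x [^] (p ^ 2) = \<one>" using b(1) by simp
  obtain C where C: "index_p C" "x \<in> C" using nc xG by (rule ex_index_p_containing)
  then obtain d r where d: "d \<in> carrier G" "ord d = p ^ (k - 1)" and r: "x = d [^] (r :: nat)"
    using gen[OF C(1)] by blast
  have "p ^ (k - 1) dvd r * p ^ 2" using xp d r by (simp add: nat_pow_pow pow_eq_id)
  \<comment> \<open>Here \<open>k \<ge> 4\<close> enters. For order \<open>p ^ 3\<close> the
    conclusion can fail: in the quaternion group of order 8 all subgroups of index 2 are
    cyclic.\<close>
  moreover have "p ^ 2 * p dvd p ^ (k - 1)"
    using k(2) le_imp_power_dvd[of 3 "k - 1" p] by (simp add: power2_eq_square power3_eq_cube)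
  ultimately have "p ^ 2 * p dvd p ^ 2 * r" by (metis dvd_trans mult.commute)
  then have "p dvd r" using pp by simp
  then obtain s where "r = s * p" by (metis dvdE mult.commute)
  then have "x = (d [^] s) [^] p" using r d(1) by (simp add: nat_pow_pow)
  then show False using xB powB d(1) by simp
qed

end

section \<open>Counting conjugacy classes of subgroups\<close>

lemma (in finite_p_group) card_index_p:
  assumes "index_p M" "card (carrier G) = p ^ Suc k" shows "card M = p ^ k"
proof -
  have "p * card M = p * p ^ k" using assms unfolding index_p_def by (metis power_Suc)
  then show ?thesis using p_gt_1 by simp
qed

lemma (in finite_p_group) ex_two_index_p_subgroups:
  assumes "\<not> cyclic_group G" "card (carrier G) = p ^ Suc k"
  shows "\<exists>H K. subgroup H G \<and> subgroup K G \<and> card H = p ^ k \<and> card K = p ^ k \<and> H \<noteq> K"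
proof -
  obtain M N where MN: "index_p M" "index_p N" "M \<noteq> N" using ex_three_index_p[OF assms(1)] by blast
  have "subgroup M G" "subgroup N G" using MN by (simp_all add: index_p_def)
  moreover have "card M = p ^ k" "card N = p ^ k"
    using MN(1,2)[THEN card_index_p, OF assms(2)] .
  ultimately show ?thesis using MN(3) by (intro exI[of _ M] exI[of _ N]) simp
qed

text \<open>The induction descends through noncyclic subgroups of index \<open>p\<close> to order
  \<open>p ^ Suc i\<close>, where two subgroups of index \<open>p\<close> serve. Because
  \<open>2 \<le> i\<close>, each group left behind has order at least \<open>p ^ 4\<close>.\<close>

lemma ex_two_subgroups_of_card:
  assumes "finite_p_group G p" "\<not> cyclic_group G" "card (carrier G) = p ^ k" "2 \<le> i" "i < k"
  shows "\<exists>H K. subgroup H G \<and> subgroup K G \<and> card H = p ^ i \<and> card K = p ^ i \<and> H \<noteq> K"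
  using assms
proof (induction k arbitrary: G)
  case 0
  from \<open>i < 0\<close> show ?case by (rule less_zeroE)
next
  case (Suc k)
  interpret finite_p_group G p by fact
  show ?case
  proof (cases "i = k")
    case True
    show ?thesis unfolding True using Suc.prems(2,3) by (rule ex_two_index_p_subgroups)
  next
    case False
    then have "i < k" "4 \<le> Suc k" using Suc.prems by auto
    then obtain M where M: "index_p M" "\<not> cyclic_group (G\<lparr>carrier := M\<rparr>)"
      using ex_noncyclic_index_p[OF Suc.prems(2,3)] by blast
    then have sM: "subgroup M G" by (simp add: index_p_def)
    have "card (carrier (G\<lparr>carrier := M\<rparr>)) = p ^ k"
      using card_index_p[OF M(1) Suc.prems(3)] by simp
    from Suc.IH[OF subgroup_finite_p_group[OF sM] M(2) this Suc.prems(4) \<open>i < k\<close>]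
    obtain H K where HK: "subgroup H (G\<lparr>carrier := M\<rparr>)" "subgroup K (G\<lparr>carrier := M\<rparr>)"
      "card H = p ^ i" "card K = p ^ i" "H \<noteq> K" by blast
    then show ?thesis
      using incl_subgroup[OF sM HK(1)] incl_subgroup[OF sM HK(2)]
      by (intro exI[of _ H] exI[of _ K]) simp
  qed
qed

section \<open>Conjugacy classes of subgroups\<close>

context group
begin

lemma conjugate_eq_image: "g <# H #> inv g = (\<lambda>h. g \<otimes> h \<otimes> inv g) ` H"
  by (auto simp: l_coset_def r_coset_def)

lemma subgroup_in_conj_class:
  assumes "subgroup H G" shows "H \<in> subgroup_conj_class G H"
proof -
  have "(\<lambda>h. \<one> \<otimes> h \<otimes> inv \<one>) ` H = H"
    using subgroup.mem_carrier[OF assms] by force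
  then show ?thesis
    unfolding subgroup_conj_class_def conjugate_eq_image by (auto intro!: exI[of _ \<one>])
qed

lemma card_conj_class:
  assumes "subgroup H G" "K \<in> subgroup_conj_class G H" shows "card K = card H"
proof -
  obtain g where g: "g \<in> carrier G" "K = (\<lambda>h. g \<otimes> h \<otimes> inv g) ` H"
    using assms(2) by (auto simp: subgroup_conj_class_def conjugate_eq_image)
  have "inj_on (\<lambda>h. g \<otimes> h \<otimes> inv g) H"
    using g(1) subgroup.mem_carrier[OF assms(1)] by (auto simp: inj_on_def)
  then show ?thesis unfolding g(2) by (rule card_image)
qed

lemma conj_class_normal:
  assumes "N \<lhd> G" shows "subgroup_conj_class G N = {N}"
proof -
  interpret N: normal N G by fact
  have "(\<lambda>h. g \<otimes> h \<otimes> inv g) ` N = N" if g: "g \<in> carrier G" for g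
  proof
    show "(\<lambda>h. g \<otimes> h \<otimes> inv g) ` N \<subseteq> N" using g N.inv_op_closed2 by blast
    show "N \<subseteq> (\<lambda>h. g \<otimes> h \<otimes> inv g) ` N"
    proof
      fix h assume h: "h \<in> N"
      have "h = g \<otimes> (inv g \<otimes> h \<otimes> g) \<otimes> inv g" using g h by (simp add: m_assoc)
      then show "h \<in> (\<lambda>h. g \<otimes> h \<otimes> inv g) ` N" using N.inv_op_closed1[OF g h] by blast
    qed
  qed
  then show ?thesis unfolding subgroup_conj_class_def conjugate_eq_image by (auto intro: one_closed)
qed

end

section \<open>Bounds for the number of classes of each order, and for the class of the
  group\<close>

context finite_p_group
begin

definition classes_of_card :: "nat \<Rightarrow> 'a set set set"
  where "classes_of_card m = subgroup_conj_class G ` {H. subgroup H G \<and> card H = m}"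

lemma finite_classes_of_card: "finite (classes_of_card m)"
proof -
  have "finite {H. subgroup H G \<and> card H = m}"
    by (rule finite_subset[of _ "Pow (carrier G)"]) (auto dest: subgroup.subset)
  then show ?thesis by (simp add: classes_of_card_def)
qed

lemma card_classes_of_card_ge_1:
  assumes "card (carrier G) = p ^ k" "i \<le> k"
  shows "card (classes_of_card (p ^ i)) \<ge> 1"
proof -
  obtain N where "N \<lhd> G" "card N = p ^ i" using ex_normal_of_card[OF assms] by blast
  then have "classes_of_card (p ^ i) \<noteq> {}"
    unfolding classes_of_card_def using normal_imp_subgroup by blast
  then show ?thesis using finite_classes_of_card by (simp add: Suc_le_eq card_gt_0_iff)
qed

text \<open>As there is a normal subgroup of each order, two subgroups of the same order yield two
  conjugacy classes.\<close>

lemma card_classes_of_card_ge_2: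
  assumes "\<not> cyclic_group G" "card (carrier G) = p ^ k" "2 \<le> i" "i < k"
  shows "card (classes_of_card (p ^ i)) \<ge> 2"
proof -
  obtain N where N: "N \<lhd> G" "card N = p ^ i"
    using ex_normal_of_card[OF assms(2)] assms(4) less_imp_le by blast
  obtain H where H: "subgroup H G" "card H = p ^ i" "H \<noteq> N"
    using ex_two_subgroups_of_card[OF finite_p_group_axioms assms] by metis
  have "subgroup_conj_class G H \<noteq> subgroup_conj_class G N"
    using subgroup_in_conj_class[OF H(1)] conj_class_normal[OF N(1)] H(3) by auto
  then have "card {subgroup_conj_class G H, subgroup_conj_class G N} = 2" by simp
  moreover have "{subgroup_conj_class G H, subgroup_conj_class G N} \<subseteq> classes_of_card (p ^ i)"
    unfolding classes_of_card_def using H N normal_imp_subgroup by blast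
  ultimately show ?thesis using finite_classes_of_card by (metis card_mono)
qed

lemma card_classes_of_card_ge_3:
  assumes "\<not> cyclic_group G" "card (carrier G) = p ^ Suc k"
  shows "card (classes_of_card (p ^ k)) \<ge> 3"
proof -
  obtain L M N where LMN: "index_p L" "index_p M" "index_p N" "L \<noteq> M" "L \<noteq> N" "M \<noteq> N"
    using assms(1) by (rule ex_three_index_p)
  have cls: "subgroup_conj_class G H = {H}" and mem: "{H} \<in> classes_of_card (p ^ k)"
    if "index_p H" for H
  proof -
    have H: "subgroup H G" "card (carrier G) = p * card H" using that by (simp_all add: index_p_def)
    show *: "subgroup_conj_class G H = {H}" using index_p_normal[OF H] by (rule conj_class_normal)
    have "card H = p ^ k" using that assms(2) by (rule card_index_p)
    then show "{H} \<in> classes_of_card (p ^ k)"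
      unfolding classes_of_card_def using H(1) * by blast
  qed
  have "card {{L}, {M}, {N}} = 3" using LMN by simp
  moreover have "{{L}, {M}, {N}} \<subseteq> classes_of_card (p ^ k)" using LMN mem by blast
  ultimately show ?thesis using finite_classes_of_card by (metis card_mono)
qed

lemma classes_of_card_disjoint:
  assumes "m \<noteq> n" shows "classes_of_card m \<inter> classes_of_card n = {}"
proof -
  have False if H: "subgroup H G" and K: "subgroup K G" and "card H = m" "card K = n"
    and eq: "subgroup_conj_class G H = subgroup_conj_class G K" for H K
    using card_conj_class[OF K, of H] subgroup_in_conj_class[OF H] that assms by simp
  then show ?thesis unfolding classes_of_card_def by blast
qed

text \<open>Subgroups of order \<open>p ^ i\<close> with \<open>0 < i < k\<close> are nontrivial and
  proper, so growth of normalizers makes \<open>D_count\<close> count their classes. Classes for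
  different orders are disjoint.\<close>

lemma sum_card_classes_le_D_count:
  assumes "card (carrier G) = p ^ k"
  shows "(\<Sum>i\<in>{1..<k}. card (classes_of_card (p ^ i))) \<le> D_count G"
proof -
  let ?S = "{subgroup_conj_class G H | H. subgroup H G \<and> H \<noteq> {\<one>} \<and> normalizer G H \<noteq> H}"
  have "finite {H. subgroup H G}"
    by (rule finite_subset[of _ "Pow (carrier G)"]) (auto dest: subgroup.subset)
  then have fin: "finite ?S"
    by (rule finite_surj[of _ _ "subgroup_conj_class G"]) blast
  have "(\<Sum>i\<in>{1..<k}. card (classes_of_card (p ^ i))) = card (\<Union>i\<in>{1..<k}. classes_of_card (p ^ i))"
  proof (rule card_UN_disjoint[symmetric])
    show "\<forall>i\<in>{1..<k}. \<forall>j\<in>{1..<k}. i \<noteq> j \<longrightarrow> classes_of_card (p ^ i) \<inter> classes_of_card (p ^ j) = {}"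
      using p_gt_1 by (auto intro!: classes_of_card_disjoint)
  qed (auto simp: finite_classes_of_card)
  also have "\<dots> \<le> card ?S"
  proof (rule card_mono[OF fin], rule UN_least)
    fix i assume i: "i \<in> {1..<k}"
    show "classes_of_card (p ^ i) \<subseteq> ?S"
    proof
      fix c assume "c \<in> classes_of_card (p ^ i)"
      then obtain H where H: "subgroup H G" "card H = p ^ i" "c = subgroup_conj_class G H"
        by (auto simp: classes_of_card_def)
      have "p ^ 0 < p ^ i" "p ^ i < p ^ k"
        using i p_gt_1 by (auto intro!: power_strict_increasing simp del: power_0)
      then have "H \<noteq> {\<one>}" "H \<noteq> carrier G" using H(2) assms by auto
      then show "c \<in> ?S" using H normalizer_strict[OF H(1)] by blast
    qed
  qed
  finally show ?thesis by (simp add: D_count_def)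
qed

text \<open>For \<open>k \<ge> 3\<close> there is at least one class for order \<open>p\<close>, two
  for each of the \<open>k - 3\<close> orders strictly between \<open>p\<close> and
  \<open>p ^ (k - 1)\<close>, and three for index \<open>p\<close>; the total is
  \<open>1 + 2 * (k - 3) + 3 = 2 * (k - 1)\<close>. For \<open>k = 2\<close> the orders
  \<open>p\<close> and \<open>p ^ (k - 1)\<close> coincide, and the three classes suffice.\<close>

lemma noncyclic_D_count_ge:
  assumes nc: "\<not> cyclic_group G" and k: "card (carrier G) = p ^ k"
  shows "k \<ge> 2" and "2 * (k - 1) \<le> D_count G"
proof -
  show k2: "k \<ge> 2"
  proof (rule ccontr)
    assume "\<not> 2 \<le> k"
    obtain M N where MN: "index_p M" "index_p N" "M \<noteq> N" using ex_three_index_p[OF nc] by blast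
    \<comment> \<open>In a group of order at most \<open>p\<close> a subgroup of index
      \<open>p\<close> is trivial, so there cannot be two of them.\<close>
    have "H = {\<one>}" if "index_p H" for H
    proof -
      have H: "subgroup H G" "p * card H = p ^ k"
        using that k unfolding index_p_def by (blast, metis)
      have "card H > 0" using H(1) finite_carrier by (rule subgroup.finite_imp_card_positive)
      moreover have "p * card H \<le> p * 1"
        using H(2) \<open>\<not> 2 \<le> k\<close> p_gt_1 power_increasing[of k 1 p] by simp
      then have "card H \<le> 1" using p_gt_1 by (simp only: mult_le_cancel1)
      ultimately have "card H = 1" by simp
      then obtain x where "H = {x}" by (rule card_1_singletonE)
      then show ?thesis using subgroup.one_closed[OF H(1)] by simp
    qed
    then show False using MN by blast
  qed
  let ?f = "\<lambda>i. card (classes_of_card (p ^ i))"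
  obtain j where j: "k = Suc (Suc j)" using k2 by (metis add_2_eq_Suc le_Suc_ex)
  have top: "?f (Suc j) \<ge> 3" using card_classes_of_card_ge_3[OF nc, of "Suc j"] k j by simp
  have "2 * Suc j \<le> (\<Sum>i\<in>{1..<Suc (Suc j)}. ?f i)"
  proof (cases j)
    case 0
    then show ?thesis using top by simp
  next
    case (Suc l)
    have "(\<Sum>i\<in>{2..<Suc j}. 2) \<le> (\<Sum>i\<in>{2..<Suc j}. ?f i)"
      using card_classes_of_card_ge_2[OF nc k] j by (intro sum_mono) auto
    moreover have "?f 1 \<ge> 1" using card_classes_of_card_ge_1[OF k, of 1] j by simp
    moreover have "(\<Sum>i\<in>{1..<Suc (Suc j)}. ?f i) = ?f 1 + (\<Sum>i\<in>{2..<Suc j}. ?f i) + ?f (Suc j)"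
    proof -
      have "{1..<Suc (Suc j)} = insert 1 (insert (Suc j) {2..<Suc j})" using Suc by auto
      then show ?thesis using Suc by simp
    qed
    ultimately show ?thesis using top Suc by simp
  qed
  also have "\<dots> \<le> D_count G" using sum_card_classes_le_D_count[OF k] j by simp
  finally show "2 * (k - 1) \<le> D_count G" using j by simp
qed

text \<open>A group modulo its centre is never cyclic of order \<open>p\<close>; here the group is
  \<open>G\<close> modulo \<open>upper_central j\<close>. For \<open>g\<close> outside
  \<open>?U\<close>, the centralizer of \<open>g\<close> modulo \<open>upper_central j\<close>
  contains both \<open>?U\<close> and \<open>g\<close>. With \<open>?U\<close> of index
  \<open>p\<close> it would be all of \<open>G\<close>, which puts \<open>g\<close> in
  \<open>?U\<close>.\<close>

lemma upper_central_not_index_p: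
  assumes "upper_central (Suc j) \<noteq> carrier G"
  shows "p * card (upper_central (Suc j)) \<noteq> card (carrier G)"
proof
  let ?U = "upper_central (Suc j)"
  assume eq: "p * card ?U = card (carrier G)"
  have U: "subgroup ?U G" by (rule normal_imp_subgroup[OF upper_central_normal])
  interpret V: normal "upper_central j" G by (rule upper_central_normal)
  obtain g where g: "g \<in> carrier G" "g \<notin> ?U"
    using assms subgroup.subset[OF U] by blast
  let ?C = "centralizer_mod (upper_central j) {g}"
  have C: "subgroup ?C G" using g by (intro subgroup_centralizer_mod V.normal_axioms) simp
  have "?U \<subseteq> ?C" using g by (auto simp: centralizer_mod_def)
  moreover have "g \<in> ?C" using g(1) by (simp add: centralizer_mod_def m_assoc)
  ultimately have "?U \<subset> ?C" using g(2) by blast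
  with U C have "p * card ?U dvd card ?C" by (rule card_psubset_subgroup)
  then have "card (carrier G) \<le> card ?C"
    unfolding eq using subgroup.finite_imp_card_positive[OF C finite_carrier] by (rule dvd_imp_le)
  then have "?C = carrier G" using subgroup.subset[OF C] by (simp add: card_seteq)
  then have "commutator g x \<in> upper_central j" if x: "x \<in> carrier G" for x
  proof -
    have "commutator x g \<in> upper_central j"
      using x \<open>?C = carrier G\<close> by (auto simp: centralizer_mod_def)
    then have "inv (commutator x g) \<in> upper_central j" by (rule V.m_inv_closed)
    then show ?thesis using x g(1) by (simp add: m_assoc inv_mult_group)
  qed
  then show False using g by (simp add: centralizer_mod_def)
qed

lemma lower_central_trivial_if_upper_central_full:
  assumes "upper_central m = carrier G" shows "lower_central G m = {\<one>}"
  using lower_central_subset_upper_central[OF assms order_refl]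
    subgroup.one_closed[OF normal_imp_subgroup[OF lower_central_normal[of m]]] by auto

text \<open>Let \<open>m\<close> be the length of the upper central series. If
  \<open>m \<ge> 2\<close>, the term before the last has order at least \<open>p ^ (m - 1)\<close>
  and index at least \<open>p ^ 2\<close>, so \<open>m + 1 \<le> k\<close>. The case
  \<open>m \<le> 1\<close> is covered by \<open>k \<ge> 2\<close>.\<close>

lemma lower_central_card:
  assumes k: "card (carrier G) = p ^ k" "k \<ge> 2"
  obtains c where "c \<le> k - 1" "lower_central G c = {\<one>}"
proof -
  define m where "m = (LEAST m. upper_central m = carrier G)"
  have m: "upper_central m = carrier G"
    unfolding m_def using ex_upper_central_eq_carrier by (rule LeastI_ex)
  have "m \<le> k - 1"
  proof (cases "m \<le> 1")
    case True
    then show ?thesis using k(2) by simp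
  next
    case False
    then obtain j where j: "m = Suc (Suc j)" by (metis One_nat_def not_less_eq_eq old.nat.exhaust le0)
    let ?U = "upper_central (Suc j)"
    have ne: "?U \<noteq> carrier G"
      using not_less_Least[of "Suc j" "\<lambda>m. upper_central m = carrier G"] j by (simp add: m_def)
    have U: "subgroup ?U G" by (rule normal_imp_subgroup[OF upper_central_normal])
    obtain r where r: "card ?U = p ^ r" using U by (rule card_subgroup)
    have "p ^ Suc j \<le> p ^ r" using card_upper_central[of "Suc j"] ne r by simp
    then have "Suc j \<le> r" using p_gt_1 by (simp only: power_increasing_iff)
    moreover have "p ^ Suc r dvd p ^ k" using card_proper_subgroup[OF U ne] r k(1) by simp
    then have "Suc r \<le> k" using p_gt_1 by (meson power_dvd_imp_le)
    moreover have "p ^ Suc r \<noteq> p ^ k" using upper_central_not_index_p[OF ne] r k(1) by simp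
    then have "Suc r \<noteq> k" by blast
    ultimately show ?thesis using j by simp
  qed
  then show thesis using that lower_central_trivial_if_upper_central_full[OF m] by blast
qed

lemma cyclic_lower_central:
  assumes "cyclic_group G" shows "lower_central G 1 = {\<one>}"
proof (rule lower_central_trivial_if_upper_central_full)
  interpret comm_group G using assms by (rule cyclic_imp_abelian_group)
  have "commutator x y = \<one>" if "x \<in> carrier G" "y \<in> carrier G" for x y
    using that by (simp add: m_comm[of x y] m_assoc)
  then show "upper_central 1 = carrier G" by (auto simp: centralizer_mod_def)
qed

end

lemma (in group) trivial_D_count:
  assumes "carrier G = {\<one>}" shows "D_count G = 0"
proof -
  have "H = {\<one>}" if "subgroup H G" for H
    using subgroup.subset[OF that] subgroup.one_closed[OF that] assms by auto
  then have "{subgroup_conj_class G H | H. subgroup H G \<and> H \<noteq> {\<one>} \<and> normalizer G H \<noteq> H} = {}"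
    by blast
  then show ?thesis by (simp only: D_count_def card.empty)
qed

theorem mainTheorem5:
  fixes G :: "('a, 'b) monoid_scheme" and p n :: nat
  assumes "Factorial_Ring.prime p" and "n > 1"
    and "p_group p G"
    and "D_count G = n"
  shows "real (nilpotency_class G) \<le> real n / 2
       \<and> real (derived_length G) \<le> log 2 (real n / 2) + 1"
proof -
  have "group G" using assms(3) by (simp add: p_group_def)
  then interpret finite_p_group G p
    using assms by (simp add: finite_p_group_def finite_p_group_axioms_def)
  \<comment> \<open>The trivial group would give \<open>n = 0\<close>. Nontriviality is what the
    bound on the derived length requires.\<close>
  have nontriv: "carrier G \<noteq> {\<one>\<^bsub>G\<^esub>}" using trivial_D_count assms by auto
  obtain c where c: "lower_central G c = {\<one>\<^bsub>G\<^esub>}" "2 * c \<le> n"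
  proof (cases "cyclic_group G")
    case True
    \<comment> \<open>A cyclic group has class at most 1, and \<open>n > 1\<close> gives
      \<open>2 * 1 \<le> n\<close>.\<close>
    then show thesis using that[of 1] cyclic_lower_central assms(2) by simp
  next
    case False
    obtain k where k: "card (carrier G) = p ^ k" by (rule card_carrier)
    obtain c where "c \<le> k - 1" "lower_central G c = {\<one>\<^bsub>G\<^esub>}"
      using k noncyclic_D_count_ge(1)[OF False k] by (rule lower_central_card)
    then show thesis using that[of c] noncyclic_D_count_ge(2)[OF False k] assms(4) by simp
  qed
  have "nilpotency_class G \<le> c" unfolding nilpotency_class_def using c(1) by (rule Least_le)
  then have cl: "2 * nilpotency_class G \<le> n" using c(2) by simp
  have "2 ^ (derived_length G - 1) \<le> nilpotency_class G"
    using c(1) nontriv by (rule two_power_derived_length_le)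
  then have "2 * 2 ^ (derived_length G - 1) \<le> n" using cl by simp
  then have "real (2 * 2 ^ (derived_length G - 1)) \<le> real n" by (simp only: of_nat_le_iff)
  then have "2 ^ (derived_length G - 1) \<le> real n / 2" by simp
  \<comment> \<open>The subtraction is on natural numbers, but
    \<open>derived_length G \<le> (derived_length G - 1) + 1\<close> holds in any case, which yields
    the summand 1 of the bound.\<close>
  then have "real (derived_length G - 1) \<le> log 2 (real n / 2)" by (simp add: le_log_of_power)
  moreover have "real (nilpotency_class G) \<le> real n / 2" using cl by linarith
  ultimately show ?thesis by linarith
qed

end
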